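(* Let $k\ge2$ be an integer and $\Delta>0$. There exists a constant $c_{k,\Delta}>0$ such that, with $m=\Delta n$ (a positive integer) and $\phi\sim\mathbf{P}_{\text{unif}}$ on $\mathcal{F}^k_{n,m}$, for $m$ large enough it holds with probability $1-o(1)$ (as $n\to\infty$ with $k,\Delta$ fixed) that $$Z(\phi) < e^{-c_{k,\Delta}\,n}\,\mathbf{E}[Z].$$
   Context: Formulas: for positive integers $n,m$ and a fixed positive integer $k$ (with $n \ge k$), $\mathcal{F}^k_{n,m}$ is the set of boolean formulas $\phi = \bigwedge_{i=1}^m C_i$ on $n$ variables $x_1,\dots,x_n$, where each clause $C_i$ is a disjunction of $k$ literals (variables or negated variables) on $k$ distinct variables. The formula is regarded as a sequence of $m$ clauses (clauses may repeat), and there are $2^k\binom{n}{k}$ possible clauses up to the order of literals; each clause is given with its $k$ literals in a uniformly random order. Under $\mathbf{P}_{\text{unif}}$, the $m$ clauses are independent and uniform among the $2^k\binom{n}{k}$ possible clauses. $Z = Z(\phi)$ is the number of assignments in $\{0,1\}^n$ that satisfy $\phi$, and $\mathbf{E}[Z]$ is its expectation under $\mathbf{P}_{\text{unif}}$. *)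

theory Defs
  imports
    "HOL-Probability.Probability"
    "HOL-Library.Landau_Symbols"
    "HOL-Combinatorics.Multiset_Permutations"
begin

(* The variables of a formula on n variables are 0, ..., n - 1. The literal (x, True) is the
   variable x and (x, False) is its negation. *)
type_synonym lit = "nat \<times> bool"
type_synonym clause = "lit list"
type_synonym formula = "clause list"

(* Clauses up to the order of literals; injectivity of fst says that the variables are distinct. *)
definition clause_sets :: "nat \<Rightarrow> nat \<Rightarrow> lit set set" where
  "clause_sets k n = {C. C \<subseteq> {..<n} \<times> UNIV \<and> card C = k \<and> inj_on fst C}"

definition clauses :: "nat \<Rightarrow> nat \<Rightarrow> clause set" where
  "clauses k n = {C. length C = k \<and> distinct (map fst C) \<and> fst ` set C \<subseteq> {..<n}}"

definition formulas :: "nat \<Rightarrow> nat \<Rightarrow> nat \<Rightarrow> formula set" where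
  "formulas k n m = {\<phi>. length \<phi> = m \<and> set \<phi> \<subseteq> clauses k n}"

(* A uniform clause up to order, whose literals are then put in a uniformly random order.
   Meaningful only for k \<le> n: otherwise clause_sets k n is empty. *)
definition random_clause :: "nat \<Rightarrow> nat \<Rightarrow> clause pmf" where
  "random_clause k n =
     bind_pmf (pmf_of_set (clause_sets k n)) (\<lambda>C. pmf_of_set (permutations_of_set C))"

definition P_unif :: "nat \<Rightarrow> nat \<Rightarrow> nat \<Rightarrow> formula pmf" where
  "P_unif k n m = replicate_pmf m (random_clause k n)"

definition assignments :: "nat \<Rightarrow> (nat \<Rightarrow> bool) set" where
  "assignments n = {..<n} \<rightarrow>\<^sub>E UNIV"

definition satisfies :: "(nat \<Rightarrow> bool) \<Rightarrow> formula \<Rightarrow> bool" where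
  "satisfies \<sigma> \<phi> \<longleftrightarrow> (\<forall>C \<in> set \<phi>. \<exists>(x, s) \<in> set C. \<sigma> x = s)"

definition Z :: "nat \<Rightarrow> formula \<Rightarrow> nat" where
  "Z n \<phi> = card {\<sigma> \<in> assignments n. satisfies \<sigma> \<phi>}"

lemma finite_clause_sets: "finite (clause_sets k n)"
  by (rule finite_subset[of _ "Pow ({..<n} \<times> UNIV)"]) (auto simp: clause_sets_def)

lemma card_clause_sets: "card (clause_sets k n) = 2 ^ k * (n choose k)"
proof -
  let ?S = "SIGMA A:{A. A \<subseteq> {..<n} \<and> card A = k}. A \<rightarrow>\<^sub>E (UNIV :: bool set)"
  let ?g = "\<lambda>(A, f). (\<lambda>x. (x, f x)) ` A :: lit set"
  have inj: "inj_on ?g ?S"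
  proof (rule inj_onI, clarify)
    fix A B :: "nat set" and f g :: "nat \<Rightarrow> bool"
    assume f: "f \<in> A \<rightarrow>\<^sub>E UNIV" and g: "g \<in> B \<rightarrow>\<^sub>E UNIV"
      and eq: "(\<lambda>x. (x, f x)) ` A = (\<lambda>x. (x, g x)) ` B"
    have "fst ` (\<lambda>x. (x, f x)) ` A = fst ` (\<lambda>x. (x, g x)) ` B"
      using eq by simp
    hence AB: "A = B" by (simp add: image_image)
    have "f x = g x" for x
    proof (cases "x \<in> A")
      case True
      hence "(x, f x) \<in> (\<lambda>x. (x, g x)) ` B" using eq by blast
      thus ?thesis by auto
    next
      case False
      thus ?thesis using f g AB by (simp add: PiE_def extensional_def)
    qed
    thus "A = B \<and> f = g" using AB by auto
  qed
  have img: "?g ` ?S = clause_sets k n"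
  proof (intro equalityI subsetI)
    fix C assume "C \<in> ?g ` ?S"
    then obtain A f where *: "A \<subseteq> {..<n}" "card A = k" "C = (\<lambda>x. (x, f x)) ` A" by auto
    have "card C = k" using * by (auto simp: card_image inj_on_def)
    thus "C \<in> clause_sets k n" using * by (auto simp: clause_sets_def inj_on_def)
  next
    fix C assume "C \<in> clause_sets k n"
    hence C: "C \<subseteq> {..<n} \<times> UNIV" "card C = k" "inj_on fst C"
      by (auto simp: clause_sets_def)
    define f where "f = restrict (\<lambda>x. snd (inv_into C fst x)) (fst ` C)"
    have "(fst p, f (fst p)) = p" if "p \<in> C" for p
      using that C(3) by (simp add: f_def)
    hence "(\<lambda>x. (x, f x)) ` fst ` C = C" by (simp add: image_image)
    moreover have "(fst ` C, f) \<in> ?S" using C by (auto simp: card_image f_def)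
    ultimately show "C \<in> ?g ` ?S" by (intro image_eqI[of _ _ "(fst ` C, f)"]) auto
  qed
  have fin: "finite A" if "A \<subseteq> {..<n}" for A using that finite_subset by blast
  have "card (clause_sets k n) = card ?S" using card_image[OF inj] img by simp
  also have "\<dots> = (\<Sum>A\<in>{A. A \<subseteq> {..<n} \<and> card A = k}. card (A \<rightarrow>\<^sub>E (UNIV :: bool set)))"
    by (rule card_SigmaI) (auto intro: finite_PiE fin)
  also have "\<dots> = (\<Sum>A\<in>{A. A \<subseteq> {..<n} \<and> card A = k}. 2 ^ k)"
    by (rule sum.cong) (simp_all add: card_PiE fin)
  also have "\<dots> = 2 ^ k * (n choose k)"
    by (simp add: n_subsets)
  finally show ?thesis .
qed

lemma clause_sets_nonempty: "k \<le> n \<Longrightarrow> clause_sets k n \<noteq> {}"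
  using card_clause_sets[of k n] by auto

lemma set_pmf_random_clause:
  assumes "k \<le> n"
  shows "set_pmf (random_clause k n) = clauses k n"
proof -
  have fin: "finite C" if "C \<in> clause_sets k n" for C
    using that finite_subset[of C "{..<n} \<times> UNIV"] by (simp add: clause_sets_def)
  have "set_pmf (random_clause k n) = (\<Union>C\<in>clause_sets k n. permutations_of_set C)"
    unfolding random_clause_def
    using clause_sets_nonempty[OF assms] finite_clause_sets fin by auto
  also have "\<dots> = clauses k n"
  proof (intro equalityI subsetI)
    fix C assume "C \<in> (\<Union>C\<in>clause_sets k n. permutations_of_set C)"
    thus "C \<in> clauses k n"
      using distinct_card[of C]
      by (auto simp: clause_sets_def clauses_def permutations_of_set_def distinct_map)
  next
    fix C assume "C \<in> clauses k n"
    hence C: "length C = k" "distinct C" "inj_on fst (set C)" "fst ` set C \<subseteq> {..<n}"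
      by (simp_all add: clauses_def distinct_map)
    have "set C \<subseteq> {..<n} \<times> UNIV" using C(4) by fastforce
    hence "set C \<in> clause_sets k n"
      using C distinct_card[of C] by (simp add: clause_sets_def)
    thus "C \<in> (\<Union>C\<in>clause_sets k n. permutations_of_set C)"
      using C(2) by (auto simp: permutations_of_set_def)
  qed
  finally show ?thesis .
qed

lemma set_pmf_P_unif:
  assumes "k \<le> n"
  shows "set_pmf (P_unif k n m) = formulas k n m"
  using set_pmf_random_clause[OF assms]
  by (auto simp: P_unif_def set_replicate_pmf formulas_def)

end

(* The planted model weights a formula by Z, that is, it draws an assignment \<sigma> uniformly and then
   m independent clauses satisfied by \<sigma>. If A is an event of probability 1 - o(1) under P_unif and
   of probability exponentially small in the planted model, then E[Z; A] = E[Z] P_planted(A), and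
   Markov's inequality on A gives the claim.

   A planted clause is satisfied by \<sigma>, so its literals are slightly more likely to agree with \<sigma>
   than to disagree, by beta = 1 / (2^k - 1) on average. To detect this without knowing \<sigma>, look at
   the first literal of every clause. From the first l <= n / 2 clauses, remember for each variable
   the first sign seen; each of these clauses shows a new variable with probability at least 1/2, so
   planted signs agree with \<sigma> on a linear surplus of variables. Then score the remaining clauses by
   the correlation of their first literals with the remembered signs: it has mean 0 under P_unif and
   a linear positive mean in the planted model. A is the event that the score is small, and both
   error probabilities follow from exponential moments. *)
theory Submission
  imports Defs
begin

section \<open>Signs, correlations and satisfaction\<close>

definition sg :: "bool \<Rightarrow> real" where
  "sg b = (if b then 1 else - 1)"

text \<open>\<open>u\<close> is a vector of guessed signs, with 0 where there is no guess; a
  positive value means that the first literal agrees with the guess.\<close>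

definition corr :: "(nat \<Rightarrow> real) \<Rightarrow> clause \<Rightarrow> real" where
  "corr u C = u (fst (hd C)) * sg (snd (hd C))"

lemma sg_not: "sg (\<not> b) = - sg b"
  by (simp add: sg_def)

lemma sg_sq: "sg b * sg b = 1"
  by (simp add: sg_def)

lemma abs_sg: "\<bar>sg b\<bar> = 1"
  by (simp add: sg_def)

lemma abs_corr: "\<bar>corr u C\<bar> = \<bar>u (fst (hd C))\<bar>"
  by (simp add: corr_def abs_mult abs_sg)

lemma satisfies_Cons: "satisfies \<sigma> (C # \<phi>) \<longleftrightarrow> satisfies \<sigma> [C] \<and> satisfies \<sigma> \<phi>"
  unfolding satisfies_def by simp

lemma satisfies_single: "satisfies \<sigma> [C] \<longleftrightarrow> (\<exists>l\<in>set C. \<sigma> (fst l) = snd l)"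
  by (simp add: satisfies_def case_prod_beta)

lemma satisfies_append: "satisfies \<sigma> (\<phi> @ \<psi>) \<longleftrightarrow> satisfies \<sigma> \<phi> \<and> satisfies \<sigma> \<psi>"
  unfolding satisfies_def set_append by (rule ball_Un)

section \<open>The uniform distribution on ordered clauses\<close>

lemma finite_clauses: "finite (clauses k n)"
proof (rule finite_subset)
  show "clauses k n \<subseteq> {C. set C \<subseteq> {..<n} \<times> UNIV \<and> length C = k}"
    unfolding clauses_def by fastforce
qed (rule finite_lists_length_eq, simp)

lemma clauses_nonempty: "k \<le> n \<Longrightarrow> clauses k n \<noteq> {}"
  using set_pmf_random_clause[of k n] set_pmf_not_empty by metis

text \<open>Every clause set has \<open>fact k\<close> orderings, and different sets share none, so
  a shuffled uniform set is a uniform ordered clause. Expectations become averages over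
  \<open>clauses k n\<close>.\<close>

lemma random_clause_uniform:
  assumes "k \<le> n"
  shows "random_clause k n = pmf_of_set (clauses k n)"
proof -
  have fin: "finite C" if "C \<in> clause_sets k n" for C
    using that finite_subset[of C "{..<n} \<times> UNIV"] by (simp add: clause_sets_def)
  have U: "clauses k n = \<Union> (permutations_of_set ` clause_sets k n)"
    using set_pmf_random_clause[OF assms] clause_sets_nonempty[OF assms] finite_clause_sets fin
    unfolding random_clause_def by auto
  show ?thesis
    unfolding U random_clause_def
  proof (rule pmf_of_set_UN[symmetric])
    show "finite (\<Union> (permutations_of_set ` clause_sets k n))"
      using finite_clauses U by metis
    show "card (permutations_of_set C) = fact k" if "C \<in> clause_sets k n" for C
      using that fin[OF that] by (simp add: clause_sets_def)
    show "disjoint_family_on permutations_of_set (clause_sets k n)"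
      by (auto simp: disjoint_family_on_def permutations_of_set_def)
  qed (use clause_sets_nonempty[OF assms] fin in auto)
qed

lemma expectation_random_clause:
  assumes "k \<le> n"
  shows "measure_pmf.expectation (random_clause k n) f = (\<Sum>C\<in>clauses k n. f C) / card (clauses k n)"
  by (simp add: random_clause_uniform[OF assms] integral_pmf_of_set finite_clauses
      clauses_nonempty[OF assms])

text \<open>Variables and signs are chosen independently, as a clause is the zip of the two
  lists.\<close>

lemma card_clauses:
  "card (clauses k n) = 2 ^ k * card {xs. length xs = k \<and> distinct xs \<and> set xs \<subseteq> {..<n}}"
proof -
  let ?D = "{xs. length xs = k \<and> distinct xs \<and> set xs \<subseteq> {..<n}}"
  let ?B = "{bs :: bool list. set bs \<subseteq> UNIV \<and> length bs = k}"
  have bij: "bij_betw (\<lambda>(xs, bs). zip xs bs) (?D \<times> ?B) (clauses k n)"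
  proof (rule bij_betwI[where g = "\<lambda>C. (map fst C, map snd C)"])
    show "(\<lambda>(xs, bs). zip xs bs) \<in> ?D \<times> ?B \<rightarrow> clauses k n"
    proof clarify
      fix xs :: "nat list" and bs :: "bool list"
      assume "set xs \<subseteq> {..<n}" "distinct xs" "k = length xs" "length bs = length xs"
      thus "zip xs bs \<in> clauses (length xs) n"
        unfolding clauses_def list.set_map[symmetric] mem_Collect_eq
        by (simp only: map_fst_zip length_zip min.idem)
    qed
  qed (auto simp: clauses_def zip_map_fst_snd)
  have "card (clauses k n) = card (?D \<times> ?B)"
    by (rule bij_betw_same_card[OF bij, symmetric])
  also have "\<dots> = card ?D * card ?B"
    by (rule card_cartesian_product)
  also have "card ?B = 2 ^ k"
    using card_lists_length_eq[of "UNIV :: bool set" k, OF finite] by (simp only: card_UNIV_bool)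
  finally show ?thesis
    by (simp only: mult.commute)
qed

section \<open>Means of functions of the first literal\<close>

text \<open>Every head has the same number of completions to a list in \<open>D\<close>, so the head
  of a uniform list in \<open>D\<close> is uniform on \<open>A\<close>.\<close>

lemma sum_hd_distinct_lists:
  fixes u :: "'a \<Rightarrow> real"
  assumes "finite A" "A \<noteq> {}" "1 \<le> k" "k \<le> card A"
  defines "D \<equiv> {xs. length xs = k \<and> distinct xs \<and> set xs \<subseteq> A}"
  shows "(\<Sum>xs\<in>D. u (hd xs)) = card D / card A * (\<Sum>x\<in>A. u x)"
proof -
  let ?E = "\<lambda>x. {ys. length ys = k - 1 \<and> distinct ys \<and> set ys \<subseteq> A - {x}}"
  define P where "P = \<Prod>{card A - 1 - (k - 1) + 1 .. card A - 1}"
  have cE: "card (?E x) = P" if "x \<in> A" for x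
    using card_lists_distinct_length_eq[of "A - {x}" "k - 1"] assms that
    by (simp add: P_def card_Diff_singleton)
  have finE: "finite (?E x)" for x
    by (rule finite_subset[OF _ finite_lists_length_eq[OF assms(1), of "k - 1"]]) auto
  have bij: "bij_betw (\<lambda>(x, ys). x # ys) (SIGMA x:A. ?E x) D"
  proof (rule bij_betwI[where g = "\<lambda>xs. (hd xs, tl xs)"])
    show "(\<lambda>xs. (hd xs, tl xs)) \<in> D \<rightarrow> (SIGMA x:A. ?E x)"
    proof
      fix xs assume "xs \<in> D"
      thus "(hd xs, tl xs) \<in> (SIGMA x:A. ?E x)"
        using assms(3) by (cases xs) (auto simp: D_def)
    qed
    show "(\<lambda>(x, ys). x # ys) (hd xs, tl xs) = xs" if "xs \<in> D" for xs
      using that assms(3) by (cases xs) (auto simp: D_def)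
  qed (use assms(3) in \<open>auto simp: D_def\<close>)
  have S: "(\<Sum>xs\<in>D. v (hd xs)) = P * (\<Sum>x\<in>A. v x)" for v :: "'a \<Rightarrow> real"
  proof -
    have "(\<Sum>xs\<in>D. v (hd xs)) = (\<Sum>(x, ys)\<in>(SIGMA x:A. ?E x). v x)"
      by (subst sum.reindex_bij_betw[OF bij, symmetric]) (simp add: case_prod_beta)
    also have "\<dots> = (\<Sum>x\<in>A. \<Sum>ys\<in>?E x. v x)"
      by (rule sum.Sigma[symmetric]) (use assms(1) finE in auto)
    also have "\<dots> = (\<Sum>x\<in>A. P * v x)"
      by (rule sum.cong[OF refl], subst sum_constant, subst cE) simp_all
    finally show ?thesis by (simp add: sum_distrib_left)
  qed
  \<comment> \<open>The constant weight 1 identifies \<open>P\<close> as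
    \<open>card D / card A\<close>, so the product never has to be evaluated.\<close>
  have "real (card D) = P * card A"
    using S[of "\<lambda>_. 1"] by simp
  moreover have "card A > 0"
    using assms by (simp add: card_gt_0_iff)
  ultimately show ?thesis
    using S[of u] by simp
qed

(* The literals of an unsatisfied clause are determined by its variables, so its first variable is
   still uniform. *)
lemma expectation_unsat:
  fixes u :: "nat \<Rightarrow> real"
  assumes "1 \<le> k" "k \<le> n"
  shows "measure_pmf.expectation (random_clause k n)
           (\<lambda>C. of_bool (\<not> satisfies \<sigma> [C]) * u (fst (hd C))) = (\<Sum>x<n. u x) / n / 2 ^ k"
proof -
  let ?D = "{xs. length xs = k \<and> distinct xs \<and> set xs \<subseteq> {..<n}}"
  let ?U = "{C \<in> clauses k n. \<not> satisfies \<sigma> [C]}"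
  let ?h = "map (\<lambda>x. (x, \<not> \<sigma> x))"
  have bij: "bij_betw ?h ?D ?U"
  proof (rule bij_betwI[where g = "map fst"])
    show "?h \<in> ?D \<rightarrow> ?U"
      by (auto simp: clauses_def satisfies_single o_def)
    show "map fst \<in> ?U \<rightarrow> ?D"
      by (auto simp: clauses_def)
    show "?h (map fst C) = C" if "C \<in> ?U" for C
    proof -
      have "(fst l, \<not> \<sigma> (fst l)) = l" if "l \<in> set C" for l
      proof -
        have "\<sigma> (fst l) \<noteq> snd l"
          using that \<open>C \<in> ?U\<close> unfolding satisfies_single by blast
        thus ?thesis by (cases l) simp
      qed
      thus ?thesis by (auto intro: map_idI)
    qed
  qed (simp add: o_def)
  have "(\<Sum>C\<in>clauses k n. of_bool (\<not> satisfies \<sigma> [C]) * u (fst (hd C))) = (\<Sum>C\<in>?U. u (fst (hd C)))"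
    by (rule sum.mono_neutral_cong_right) (auto simp: finite_clauses)
  also have "\<dots> = (\<Sum>xs\<in>?D. u (hd xs))"
    by (subst sum.reindex_bij_betw[OF bij, symmetric], rule sum.cong)
       (use assms in \<open>auto simp: hd_map Suc_le_length_iff\<close>)
  also have "\<dots> = card ?D / n * (\<Sum>x<n. u x)"
    using sum_hd_distinct_lists[of "{..<n}" k u] assms by (auto simp: lessThan_empty_iff)
  finally have S: "(\<Sum>C\<in>clauses k n. of_bool (\<not> satisfies \<sigma> [C]) * u (fst (hd C)))
      = card ?D / n * (\<Sum>x<n. u x)" .
  have "card ?D \<noteq> 0"
  proof
    assume "card ?D = 0"
    hence "card (clauses k n) = 0" unfolding card_clauses by (simp only: mult_0_right)
    thus False using clauses_nonempty[OF assms(2)] finite_clauses[of k n] by simp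
  qed
  thus ?thesis
    unfolding expectation_random_clause[OF assms(2)] S card_clauses by (simp add: field_simps)
qed

lemma integrable_random_clause [simp]:
  fixes f :: "clause \<Rightarrow> real"
  assumes "k \<le> n"
  shows "integrable (random_clause k n) f"
  by (rule integrable_measure_pmf_finite) (simp add: set_pmf_random_clause[OF assms] finite_clauses)

lemma expectation_sat:
  assumes "1 \<le> k" "k \<le> n"
  shows "measure_pmf.expectation (random_clause k n) (\<lambda>C. of_bool (satisfies \<sigma> [C]))
         = (1 - 1 / 2 ^ k :: real)"
proof -
  let ?E = "measure_pmf.expectation (random_clause k n) :: (clause \<Rightarrow> real) \<Rightarrow> real"
  \<comment> \<open>The complementary event with constant weight 1, written in the form that
    \<open>expectation_unsat\<close> treats.\<close>
  have "?E (\<lambda>C. of_bool (satisfies \<sigma> [C])) = ?E (\<lambda>C. 1 - of_bool (\<not> satisfies \<sigma> [C]) * (\<lambda>_. 1) (fst (hd C)))"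
    by (intro Bochner_Integration.integral_cong) (simp_all add: of_bool_def)
  also have "\<dots> = 1 - ?E (\<lambda>C. of_bool (\<not> satisfies \<sigma> [C]) * (\<lambda>_. 1) (fst (hd C)))"
    by (subst Bochner_Integration.integral_diff) (use assms in auto)
  finally show ?thesis
    using expectation_unsat[OF assms, of \<sigma> "\<lambda>_. 1"] assms by simp
qed

text \<open>Negating the first literal is an involution on clauses that reverses the sign of the
  correlation.\<close>

lemma expectation_corr:
  assumes "1 \<le> k" "k \<le> n"
  shows "measure_pmf.expectation (random_clause k n) (corr u) = 0"
proof -
  let ?f = "\<lambda>C. (fst (hd C), \<not> snd (hd C)) # tl C"
  have ne: "C \<noteq> []" if "C \<in> clauses k n" for C
    using that assms by (auto simp: clauses_def)
  have f: "?f C \<in> clauses k n" if "C \<in> clauses k n" for C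
    using that ne[OF that] by (cases C) (auto simp: clauses_def)
  have "(\<Sum>C\<in>clauses k n. corr u C) = (\<Sum>C\<in>clauses k n. - corr u C)"
    by (rule sum.reindex_bij_witness[of _ ?f ?f]) (use f ne in \<open>auto simp: corr_def sg_not\<close>)
  thus ?thesis
    unfolding expectation_random_clause[OF assms(2)] by (simp add: sum_negf)
qed

(* Without the indicator the mean is 0, so only the unsatisfied clauses contribute; in those the
   first literal always disagrees with \<sigma>. *)
lemma expectation_sat_corr:
  assumes "1 \<le> k" "k \<le> n"
  shows "measure_pmf.expectation (random_clause k n) (\<lambda>C. of_bool (satisfies \<sigma> [C]) * corr u C)
         = (\<Sum>x<n. u x * sg (\<sigma> x)) / n / 2 ^ k"
proof -
  let ?E = "measure_pmf.expectation (random_clause k n) :: (clause \<Rightarrow> real) \<Rightarrow> real"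
  let ?g = "\<lambda>C. of_bool (\<not> satisfies \<sigma> [C]) * (\<lambda>x. u x * sg (\<sigma> x)) (fst (hd C))"
  have "of_bool (satisfies \<sigma> [C]) * corr u C = corr u C + ?g C" if "C \<in> clauses k n" for C
  proof (cases "satisfies \<sigma> [C]")
    case False
    hence "\<sigma> (fst (hd C)) = (\<not> snd (hd C))"
      using that assms by (cases C) (auto simp: satisfies_single clauses_def)
    thus ?thesis using False by (simp add: corr_def sg_not)
  qed simp
  hence "?E (\<lambda>C. of_bool (satisfies \<sigma> [C]) * corr u C) = ?E (\<lambda>C. corr u C + ?g C)"
    by (intro integral_cong_AE AE_pmfI)
       (simp_all add: set_pmf_random_clause[OF assms(2)] del: of_bool_not_iff)
  also have "\<dots> = ?E (corr u) + ?E ?g"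
    by (rule Bochner_Integration.integral_add) (use assms in auto)
  finally show ?thesis
    using expectation_unsat[OF assms, of \<sigma> "\<lambda>x. u x * sg (\<sigma> x)"] expectation_corr[OF assms, of u]
    by simp
qed

section \<open>Exponential moments with a weight\<close>

text \<open>For a negative argument -y, exp(-y) <= 1 / (1 + y), and the comparison with the
  quadratic follows from (1 - y + y^2)(1 + y) = 1 + y^3.\<close>

lemma exp_le_quadratic:
  fixes x :: real
  assumes "\<bar>x\<bar> \<le> 1"
  shows "exp x \<le> 1 + x + x\<^sup>2"
proof (cases "0 \<le> x")
  case True
  thus ?thesis using exp_bound[of x] assms by simp
next
  case False
  define y where "y = - x"
  have y: "0 \<le> y" "y \<le> 1" using False assms by (auto simp: y_def)
  have "1 + y \<le> exp y" by (rule exp_ge_add_one_self)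
  hence "exp (- y) \<le> 1 / (1 + y)"
    using y by (simp add: exp_minus field_simps)
  also have "\<dots> \<le> 1 - y + y\<^sup>2"
  proof -
    have "(1 - y + y\<^sup>2) * (1 + y) = 1 + y ^ 3" by (simp add: algebra_simps power2_eq_square power3_eq_cube)
    also have "\<dots> \<ge> 1" using y by simp
    finally show ?thesis using y by (simp add: divide_le_eq)
  qed
  finally show ?thesis by (simp add: y_def)
qed

text \<open>The weight lets one bound serve both models: \<open>w = 1\<close> gives the uniform law,
  the indicator of satisfaction gives the unnormalized planted law, and \<open>\<gamma>\<close>
  bounds the weighted mean of \<open>h\<close> from below. The exponential is replaced by its
  quadratic bound, and 1 + z <= exp z restores the exponential form.\<close>

lemma weighted_chernoff:
  fixes w h :: "'a \<Rightarrow> real"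
  assumes fin: "finite (set_pmf p)"
    and w: "\<And>x. 0 \<le> w x" and h: "\<And>x. \<bar>h x\<bar> \<le> 1"
    and mean: "\<gamma> * measure_pmf.expectation p w \<le> measure_pmf.expectation p (\<lambda>x. w x * h x)"
    and t: "0 \<le> t" "t \<le> 1"
  shows "measure_pmf.expectation p (\<lambda>x. w x * exp (- t * h x))
         \<le> measure_pmf.expectation p w * exp (t\<^sup>2 - t * \<gamma>)"
proof -
  let ?E = "measure_pmf.expectation p"
  have int: "integrable p f" for f :: "'a \<Rightarrow> real"
    by (rule integrable_measure_pmf_finite[OF fin])
  have "exp (- t * h x) \<le> (1 + t\<^sup>2) - t * h x" for x
  proof -
    have "\<bar>- t * h x\<bar> \<le> 1 * 1"
      unfolding abs_mult by (rule mult_mono) (use t h in auto)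
    hence "exp (- t * h x) \<le> 1 + (- t * h x) + (- t * h x)\<^sup>2"
      by (intro exp_le_quadratic) simp
    moreover have "(- t * h x)\<^sup>2 \<le> t\<^sup>2 * 1"
      unfolding power_mult_distrib by (rule mult_mono) (use h[of x] in \<open>auto simp: abs_square_le_1\<close>)
    ultimately show ?thesis by simp
  qed
  hence "?E (\<lambda>x. w x * exp (- t * h x)) \<le> ?E (\<lambda>x. w x * ((1 + t\<^sup>2) - t * h x))"
    by (intro integral_mono int mult_left_mono w)
  also have "\<dots> = ?E (\<lambda>x. (1 + t\<^sup>2) * w x - t * (w x * h x))"
    by (simp add: algebra_simps)
  also have "\<dots> = (1 + t\<^sup>2) * ?E w - t * ?E (\<lambda>x. w x * h x)"
    by (subst Bochner_Integration.integral_diff) (simp_all add: int)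
  also have "\<dots> \<le> (1 + t\<^sup>2) * ?E w - t * (\<gamma> * ?E w)"
    using mult_left_mono[OF mean t(1)] by simp
  also have "\<dots> = ?E w * (1 + (t\<^sup>2 - t * \<gamma>))"
    by (simp add: algebra_simps)
  also have "\<dots> \<le> ?E w * exp (t\<^sup>2 - t * \<gamma>)"
    by (intro mult_left_mono exp_ge_add_one_self Bochner_Integration.integral_nonneg w)
  finally show ?thesis .
qed

section \<open>Independent clauses and the memory of first signs\<close>

lemma finite_set_replicate_pmf:
  assumes "finite (set_pmf p)"
  shows "finite (set_pmf (replicate_pmf m p))"
  using finite_lists_length_eq[OF assms, of m]
  by (simp add: set_replicate_pmf lists_eq_set conj_commute)

lemma expectation_bind_finite:
  fixes h :: "'b \<Rightarrow> real"
  assumes "finite (set_pmf p)" "\<And>x. x \<in> set_pmf p \<Longrightarrow> finite (set_pmf (f x))"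
  shows "measure_pmf.expectation (bind_pmf p f) h
         = measure_pmf.expectation p (\<lambda>x. measure_pmf.expectation (f x) h)"
  by (subst pmf_expectation_bind[OF assms]; (simp add: assms)?)
     (subst integral_measure_pmf[OF assms(1)]; simp)

text \<open>Separates the clauses used for learning from those that are scored; given the former,
  the memory is a fixed vector.\<close>

lemma expectation_replicate_append:
  fixes h :: "'a list \<Rightarrow> real"
  assumes "finite (set_pmf p)"
  shows "measure_pmf.expectation (replicate_pmf (l + m) p) h
         = measure_pmf.expectation (replicate_pmf l p)
             (\<lambda>xs. measure_pmf.expectation (replicate_pmf m p) (\<lambda>ys. h (xs @ ys)))"
  by (simp add: replicate_pmf_distrib expectation_bind_finite finite_set_replicate_pmf assms)

lemma expectation_replicate_Suc:
  fixes h :: "'a list \<Rightarrow> real"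
  assumes "finite (set_pmf p)"
  shows "measure_pmf.expectation (replicate_pmf (Suc m) p) h
         = measure_pmf.expectation p
             (\<lambda>x. measure_pmf.expectation (replicate_pmf m p) (\<lambda>xs. h (x # xs)))"
  by (simp add: expectation_bind_finite finite_set_replicate_pmf assms)

lemma expectation_replicate_prod_list:
  fixes f :: "'a \<Rightarrow> real"
  assumes "finite (set_pmf p)"
  shows "measure_pmf.expectation (replicate_pmf m p) (\<lambda>xs. prod_list (map f xs))
         = measure_pmf.expectation p f ^ m"
  by (induction m) (simp_all add: expectation_replicate_Suc[OF assms] del: replicate_pmf.simps(2))

(* The value 0 marks a variable that has not been seen. *)
definition remember :: "clause \<Rightarrow> (nat \<Rightarrow> real) \<Rightarrow> (nat \<Rightarrow> real)" where
  "remember C s = (if s (fst (hd C)) = 0 then s(fst (hd C) := sg (snd (hd C))) else s)"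

text \<open>For \<open>s\<close> with values 0, 1 and -1 this is the number of remembered signs that
  agree with \<open>\<sigma>\<close> minus the number that disagree.\<close>

definition balance :: "nat \<Rightarrow> (nat \<Rightarrow> bool) \<Rightarrow> (nat \<Rightarrow> real) \<Rightarrow> real" where
  "balance n \<sigma> s = (\<Sum>x<n. s x * sg (\<sigma> x))"

definition score :: "(nat \<Rightarrow> real) \<Rightarrow> formula \<Rightarrow> real" where
  "score s \<phi> = (\<Sum>C\<leftarrow>\<phi>. corr s C)"

text \<open>No assignment enters, so a bound on this score is a single event that serves all
  assignments at once.\<close>

definition split_score :: "nat \<Rightarrow> formula \<Rightarrow> real" where
  "split_score l \<phi> = score (fold remember (take l \<phi>) (\<lambda>_. 0)) (drop l \<phi>)"

lemma abs_fold_remember: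
  assumes "\<And>x. \<bar>s x\<bar> \<le> 1"
  shows "\<bar>fold remember \<phi> s x\<bar> \<le> 1"
  using assms
proof (induction \<phi> arbitrary: s)
  case (Cons C \<phi>)
  have "\<bar>remember C s y\<bar> \<le> 1" for y
    using Cons.prems by (simp add: remember_def abs_sg)
  thus ?case using Cons.IH by simp
qed simp

text \<open>The change of the balance is itself a correlation, with the vector that equals the signs
  of \<open>\<sigma>\<close> on unseen variables and 0 elsewhere. Hence the bounds for one clause
  also control the learning phase.\<close>

lemma balance_remember:
  assumes "fst (hd C) < n"
  shows "balance n \<sigma> (remember C s)
         = balance n \<sigma> s + corr (\<lambda>x. if s x = 0 then sg (\<sigma> x) else 0) C"
proof (cases "s (fst (hd C)) = 0")
  case True
  let ?x = "fst (hd C)"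
  have "balance n \<sigma> (remember C s)
        = (\<Sum>x<n. s x * sg (\<sigma> x) + (if x = ?x then sg (snd (hd C)) * sg (\<sigma> ?x) else 0))"
    unfolding balance_def by (rule sum.cong) (auto simp: remember_def True)
  also have "\<dots> = balance n \<sigma> s + sg (snd (hd C)) * sg (\<sigma> ?x)"
    using assms by (simp add: sum.distrib balance_def)
  finally show ?thesis
    using True by (simp add: corr_def mult.commute)
qed (simp add: remember_def corr_def)

lemma card_remember:
  "card {x. x < n \<and> remember C s x \<noteq> 0} \<le> Suc (card {x. x < n \<and> s x \<noteq> 0})"
proof -
  have "card {x. x < n \<and> remember C s x \<noteq> 0} \<le> card (insert (fst (hd C)) {x. x < n \<and> s x \<noteq> 0})"
    by (rule card_mono) (auto simp: remember_def split: if_splits)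
  also have "\<dots> \<le> Suc (card {x. x < n \<and> s x \<noteq> 0})"
    by (rule card_insert_le_m1) simp_all
  finally show ?thesis .
qed

section \<open>Chernoff bounds in the planted and the uniform model\<close>

locale clause_params =
  fixes k n :: nat
  assumes k_pos: "1 \<le> k" and k_le: "k \<le> n"
begin

text \<open>\<open>rho\<close> is the probability that a random clause is satisfied by a fixed
  assignment; \<open>beta\<close> is the mean agreement of its first literal with that assignment,
  conditioned on satisfaction.\<close>

definition rho :: real where "rho = 1 - 1 / 2 ^ k"
definition beta :: real where "beta = 1 / (2 ^ k - 1)"

lemma two_power_k: "(2::real) \<le> 2 ^ k"
  using power_increasing[of 1 k "2::real"] k_pos by simp

lemma rho_pos: "0 < rho"
  using two_power_k by (simp add: rho_def)

lemma beta_pos: "0 < beta"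
  using two_power_k by (simp add: beta_def)

lemma beta_le: "beta \<le> 1"
  using two_power_k by (simp add: beta_def)

lemma beta_rho: "beta * rho = 1 / 2 ^ k"
  using two_power_k by (simp add: beta_def rho_def field_simps)

lemma finite_support: "finite (set_pmf (random_clause k n))"
  by (simp add: set_pmf_random_clause[OF k_le] finite_clauses)

lemma integrable_formula:
  fixes f :: "formula \<Rightarrow> real"
  shows "integrable (replicate_pmf m (random_clause k n)) f"
  by (rule integrable_measure_pmf_finite[OF finite_set_replicate_pmf[OF finite_support]])

lemma hd_less: "C \<in> clauses k n \<Longrightarrow> fst (hd C) < n"
  using k_pos by (cases C) (auto simp: clauses_def)

lemma sat_chernoff:
  assumes u: "\<And>x. \<bar>u x\<bar> \<le> 1" and g: "\<gamma> \<le> beta * (balance n \<sigma> u / n)" and t: "0 \<le> t" "t \<le> 1"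
  shows "measure_pmf.expectation (random_clause k n)
           (\<lambda>C. of_bool (satisfies \<sigma> [C]) * exp (- t * corr u C)) \<le> rho * exp (t\<^sup>2 - t * \<gamma>)"
proof -
  \<comment> \<open>As \<open>beta * rho\<close> is \<open>1 / 2 ^ k\<close>, the mean in
    \<open>expectation_sat_corr\<close> is \<open>beta * (balance n \<sigma> u / n)\<close> times
    the total weight \<open>rho\<close>.\<close>
  have "\<gamma> * rho \<le> beta * (balance n \<sigma> u / n) * rho"
    using g rho_pos by (intro mult_right_mono) auto
  also have "\<dots> = balance n \<sigma> u / n * (beta * rho)"
    by simp
  also have "\<dots> = balance n \<sigma> u / n / 2 ^ k"
    unfolding beta_rho by simp
  finally have "\<gamma> * rho \<le> balance n \<sigma> u / n / 2 ^ k" .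
  thus ?thesis
    using weighted_chernoff[OF finite_support, of "\<lambda>C. of_bool (satisfies \<sigma> [C])" "corr u" \<gamma> t]
      expectation_sat[OF k_pos k_le, of \<sigma>] expectation_sat_corr[OF k_pos k_le, of \<sigma> u] u t
    by (simp add: abs_corr rho_def balance_def)
qed

text \<open>The mean correlation is 0, so only the quadratic term remains; negating \<open>u\<close>
  turns the lower tail bound into an upper one.\<close>

lemma unif_chernoff:
  assumes u: "\<And>x. \<bar>u x\<bar> \<le> 1" and t: "0 \<le> t" "t \<le> 1"
  shows "measure_pmf.expectation (random_clause k n) (\<lambda>C. exp (t * corr u C)) \<le> exp (t\<^sup>2)"
  using weighted_chernoff[OF finite_support, of "\<lambda>_. 1" "corr (\<lambda>x. - u x)" 0 t]
    expectation_corr[OF k_pos k_le, of "\<lambda>x. - u x"] u t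
  by (simp add: abs_corr) (simp add: corr_def)

lemma expectation_sat_formula:
  "measure_pmf.expectation (replicate_pmf m (random_clause k n)) (\<lambda>\<phi>. of_bool (satisfies \<sigma> \<phi>))
   = rho ^ m"
proof -
  have "of_bool (satisfies \<sigma> \<phi>) = prod_list (map (\<lambda>C. of_bool (satisfies \<sigma> [C]) :: real) \<phi>)" for \<phi>
  proof (induction \<phi>)
    case Nil
    show ?case by (simp add: satisfies_def)
  next
    case (Cons C \<phi>)
    have "of_bool (satisfies \<sigma> (C # \<phi>)) = (of_bool (satisfies \<sigma> [C]) * of_bool (satisfies \<sigma> \<phi>) :: real)"
      by (subst satisfies_Cons) (rule of_bool_conj)
    thus ?case by (simp only: Cons.IH list.map prod_list.Cons)
  qed
  hence "measure_pmf.expectation (replicate_pmf m (random_clause k n)) (\<lambda>\<phi>. of_bool (satisfies \<sigma> \<phi>) :: real)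
      = measure_pmf.expectation (replicate_pmf m (random_clause k n))
          (\<lambda>\<phi>. prod_list (map (\<lambda>C. of_bool (satisfies \<sigma> [C])) \<phi>))"
    by (intro Bochner_Integration.integral_cong refl)
  also have "\<dots> = rho ^ m"
    by (simp add: expectation_replicate_prod_list finite_support expectation_sat[OF k_pos k_le] rho_def)
  finally show ?thesis .
qed

text \<open>The vector \<open>u\<close> does not depend on the clauses, so both the indicator and
  the exponential factor over independent clauses.\<close>

lemma sat_score_chernoff:
  assumes u: "\<And>x. \<bar>u x\<bar> \<le> 1" and g: "\<gamma> \<le> beta * (balance n \<sigma> u / n)" and t: "0 \<le> t" "t \<le> 1"
  shows "measure_pmf.expectation (replicate_pmf m (random_clause k n))
           (\<lambda>\<phi>. of_bool (satisfies \<sigma> \<phi>) * exp (- t * score u \<phi>)) \<le> (rho * exp (t\<^sup>2 - t * \<gamma>)) ^ m"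
proof -
  have "of_bool (satisfies \<sigma> \<phi>) * exp (- t * score u \<phi>)
    = prod_list (map (\<lambda>C. of_bool (satisfies \<sigma> [C]) * exp (- t * corr u C) :: real) \<phi>)" for \<phi>
  proof (induction \<phi>)
    case Nil
    show ?case by (simp add: satisfies_def score_def)
  next
    case (Cons C \<phi>)
    have "of_bool (satisfies \<sigma> (C # \<phi>)) = (of_bool (satisfies \<sigma> [C]) * of_bool (satisfies \<sigma> \<phi>) :: real)"
      by (subst satisfies_Cons) (rule of_bool_conj)
    moreover have "exp (- t * score u (C # \<phi>)) = exp (- t * corr u C) * exp (- t * score u \<phi>)"
      by (simp add: score_def exp_add[symmetric] algebra_simps)
    ultimately show ?case by (simp only: Cons.IH[symmetric] list.map prod_list.Cons mult_ac)
  qed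
  thus ?thesis
    by (simp only: expectation_replicate_prod_list[OF finite_support])
       (intro power_mono sat_chernoff assms Bochner_Integration.integral_nonneg, simp)
qed

lemma unif_score_chernoff:
  assumes u: "\<And>x. \<bar>u x\<bar> \<le> 1" and t: "0 \<le> t" "t \<le> 1"
  shows "measure_pmf.expectation (replicate_pmf m (random_clause k n)) (\<lambda>\<phi>. exp (t * score u \<phi>))
         \<le> exp (t\<^sup>2) ^ m"
proof -
  have "exp (t * score u \<phi>) = prod_list (map (\<lambda>C. exp (t * corr u C)) \<phi>)" for \<phi>
    by (induction \<phi>) (simp_all add: score_def distrib_left exp_add)
  thus ?thesis
    by (simp only: expectation_replicate_prod_list[OF finite_support])
       (intro power_mono unif_chernoff assms Bochner_Integration.integral_nonneg, simp)
qed

(* At most half of the variables are remembered at any time, so each clause has drift at least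
   beta / 2. *)
lemma sat_memory_chernoff:
  assumes "2 * (card {x. x < n \<and> s x \<noteq> 0} + l) \<le> n" and t: "0 \<le> t" "t \<le> 1"
  shows "measure_pmf.expectation (replicate_pmf l (random_clause k n))
           (\<lambda>\<phi>. of_bool (satisfies \<sigma> \<phi>) * exp (- t * balance n \<sigma> (fold remember \<phi> s)))
         \<le> (rho * exp (t\<^sup>2 - t * (beta / 2))) ^ l * exp (- t * balance n \<sigma> s)"
  using assms(1)
proof (induction l arbitrary: s)
  case 0
  show ?case by (simp add: satisfies_def)
next
  case (Suc l)
  let ?p = "random_clause k n"
  let ?K = "rho * exp (t\<^sup>2 - t * (beta / 2))"
  let ?v = "\<lambda>x. if s x = 0 then sg (\<sigma> x) else 0"
  let ?F = "\<lambda>s. measure_pmf.expectation (replicate_pmf l ?p)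
    (\<lambda>\<phi>. of_bool (satisfies \<sigma> \<phi>) * exp (- t * balance n \<sigma> (fold remember \<phi> s)))"
  have K: "0 \<le> ?K" using rho_pos by simp
  have n_pos: "0 < n" using k_pos k_le by simp
  have v: "\<bar>?v x\<bar> \<le> 1" for x by (simp add: abs_sg)
  \<comment> \<open>Squared signs are 1, so this balance counts the unseen variables.\<close>
  have "balance n \<sigma> ?v = (\<Sum>x<n. if s x = 0 then 1 else 0)"
    unfolding balance_def by (rule sum.cong) (auto simp: sg_sq)
  also have "\<dots> = card ({..<n} - {x. x < n \<and> s x \<noteq> 0})"
    by (simp add: sum.If_cases) (rule arg_cong[where f = card], auto)
  also have "\<dots> = real n - card {x. x < n \<and> s x \<noteq> 0}"
    by (subst card_Diff_subset) (use Suc.prems in \<open>auto simp: of_nat_diff\<close>)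
  finally have "n / 2 \<le> balance n \<sigma> ?v"
    using of_nat_mono[OF Suc.prems, where 'a = real] by simp
  hence "1 / 2 \<le> balance n \<sigma> ?v / n"
    using n_pos by (simp add: field_simps)
  hence g: "beta / 2 \<le> beta * (balance n \<sigma> ?v / n)"
    using mult_left_mono[OF _ less_imp_le[OF beta_pos], of "1 / 2"] by fastforce
  have "measure_pmf.expectation (replicate_pmf (Suc l) ?p)
      (\<lambda>\<phi>. of_bool (satisfies \<sigma> \<phi>) * exp (- t * balance n \<sigma> (fold remember \<phi> s)))
    = measure_pmf.expectation ?p (\<lambda>C. of_bool (satisfies \<sigma> [C]) * ?F (remember C s))"
    unfolding expectation_replicate_Suc[OF finite_support]
    by (subst satisfies_Cons) (simp only: of_bool_conj mult.assoc fold_simps integral_mult_right_zero)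
  also have "\<dots> \<le> measure_pmf.expectation ?p (\<lambda>C. ?K ^ l * exp (- t * balance n \<sigma> s) *
      (of_bool (satisfies \<sigma> [C]) * exp (- t * corr ?v C)))"
  proof (rule integral_mono_AE)
    show "AE C in ?p. of_bool (satisfies \<sigma> [C]) * ?F (remember C s)
      \<le> ?K ^ l * exp (- t * balance n \<sigma> s) * (of_bool (satisfies \<sigma> [C]) * exp (- t * corr ?v C))"
    proof (rule AE_pmfI)
      fix C assume "C \<in> set_pmf ?p"
      hence x: "fst (hd C) < n"
        using hd_less by (simp add: set_pmf_random_clause[OF k_le])
      \<comment> \<open>A clause adds at most one variable to the memory while the number of clauses
        to come drops by one, so the bound by \<open>n\<close> survives.\<close>
      have "?F (remember C s) \<le> ?K ^ l * exp (- t * balance n \<sigma> (remember C s))"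
      proof (rule Suc.IH)
        have "card {x. x < n \<and> remember C s x \<noteq> 0} \<le> Suc (card {x. x < n \<and> s x \<noteq> 0})"
          by (rule card_remember)
        thus "2 * (card {x. x < n \<and> remember C s x \<noteq> 0} + l) \<le> n"
          using Suc.prems by simp
      qed
      also have "exp (- t * balance n \<sigma> (remember C s))
          = exp (- t * balance n \<sigma> s) * exp (- t * corr ?v C)"
        unfolding balance_remember[OF x] by (simp add: exp_add[symmetric] algebra_simps)
      finally show "of_bool (satisfies \<sigma> [C]) * ?F (remember C s)
        \<le> ?K ^ l * exp (- t * balance n \<sigma> s) * (of_bool (satisfies \<sigma> [C]) * exp (- t * corr ?v C))"
        by (cases "satisfies \<sigma> [C]") (simp_all add: mult.assoc)
    qed
  qed (simp_all add: k_le)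
  also have "\<dots> = ?K ^ l * exp (- t * balance n \<sigma> s) *
      measure_pmf.expectation ?p (\<lambda>C. of_bool (satisfies \<sigma> [C]) * exp (- t * corr ?v C))"
    by (rule integral_mult_right_zero)
  also have "\<dots> \<le> ?K ^ l * exp (- t * balance n \<sigma> s) * ?K"
    by (rule mult_left_mono[OF sat_chernoff[OF v g t]]) (use K in simp)
  finally show ?case by (simp add: mult_ac)
qed

(* The planted model is kept unnormalized, as P_unif with density the indicator of satisfaction.
   The first error term is the failure to learn a surplus \<delta> n of correct signs, the second is a
   small score in spite of that surplus. *)
lemma planted_score_small:
  fixes t u \<delta> \<tau> :: real
  assumes l: "2 * l \<le> n" and t: "0 \<le> t" "t \<le> 1" and u: "0 \<le> u" "u \<le> 1"
  shows "measure_pmf.expectation (replicate_pmf (l + m) (random_clause k n))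
           (\<lambda>\<phi>. of_bool (satisfies \<sigma> \<phi>) * of_bool (split_score l \<phi> \<le> \<tau> * m))
         \<le> rho ^ (l + m) * (exp (t * \<delta> * n + l * (t\<^sup>2 - t * (beta / 2)))
             + exp (m * (u * \<tau> + u\<^sup>2 - u * (beta * \<delta>))))"
proof -
  let ?E = "\<lambda>m. measure_pmf.expectation (replicate_pmf m (random_clause k n)) :: (formula \<Rightarrow> real) \<Rightarrow> real"
  let ?s = "\<lambda>\<phi>. fold remember \<phi> (\<lambda>_. 0)"
  let ?B = "exp (m * (u * \<tau> + u\<^sup>2 - u * (beta * \<delta>)))"
  have n_pos: "0 < n" using k_pos k_le by simp
  have s: "\<bar>?s \<phi> x\<bar> \<le> 1" for \<phi> x by (rule abs_fold_remember) simp
  \<comment> \<open>A sum of two terms, so that either case needs only one: with enough surplus the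
    Chernoff bound gives \<open>?B\<close>, and otherwise the first exponential is at least 1 and
    the probability of satisfaction suffices.\<close>
  have inner: "?E m (\<lambda>\<psi>. of_bool (satisfies \<sigma> \<psi>) * of_bool (score (?s \<phi>) \<psi> \<le> \<tau> * m))
      \<le> rho ^ m * (exp (t * (\<delta> * n - balance n \<sigma> (?s \<phi>))) + ?B)" (is "?L \<le> _") for \<phi>
  proof (cases "\<delta> * n \<le> balance n \<sigma> (?s \<phi>)")
    case True
    hence g: "beta * \<delta> \<le> beta * (balance n \<sigma> (?s \<phi>) / n)"
      using beta_pos n_pos by (intro mult_left_mono) (simp_all add: field_simps)
    have "?L \<le> ?E m (\<lambda>\<psi>. exp (u * \<tau> * m) * (of_bool (satisfies \<sigma> \<psi>) * exp (- u * score (?s \<phi>) \<psi>)))"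
    proof (rule integral_mono[OF integrable_formula integrable_formula])
      fix \<psi>
      have "of_bool (score (?s \<phi>) \<psi> \<le> \<tau> * m) \<le> exp (u * (\<tau> * m - score (?s \<phi>) \<psi>))"
        using u by (auto simp: of_bool_def)
      also have "\<dots> = exp (u * \<tau> * m) * exp (- u * score (?s \<phi>) \<psi>)"
        by (simp add: exp_add[symmetric] algebra_simps)
      finally show "of_bool (satisfies \<sigma> \<psi>) * of_bool (score (?s \<phi>) \<psi> \<le> \<tau> * m)
        \<le> exp (u * \<tau> * m) * (of_bool (satisfies \<sigma> \<psi>) * exp (- u * score (?s \<phi>) \<psi>))"
        by (cases "satisfies \<sigma> \<psi>") simp_all
    qed
    also have "\<dots> \<le> exp (u * \<tau> * m) * (rho * exp (u\<^sup>2 - u * (beta * \<delta>))) ^ m"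
      unfolding integral_mult_right_zero by (intro mult_left_mono sat_score_chernoff s g u) simp
    also have "\<dots> = rho ^ m * ?B"
      by (simp add: power_mult_distrib exp_of_nat_mult[symmetric] exp_add[symmetric] algebra_simps)
    also have "\<dots> \<le> rho ^ m * (exp (t * (\<delta> * n - balance n \<sigma> (?s \<phi>))) + ?B)"
      using rho_pos by (intro mult_left_mono) auto
    finally show ?thesis .
  next
    case False
    have "?L \<le> ?E m (\<lambda>\<psi>. of_bool (satisfies \<sigma> \<psi>))"
      by (rule integral_mono[OF integrable_formula integrable_formula]) (simp add: of_bool_def)
    also have "\<dots> = rho ^ m * 1"
      by (simp add: expectation_sat_formula)
    also have "\<dots> \<le> rho ^ m * (exp (t * (\<delta> * n - balance n \<sigma> (?s \<phi>))) + ?B)"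
      using rho_pos t False by (intro mult_left_mono add_increasing2) auto
    finally show ?thesis .
  qed
  have "?E (l + m) (\<lambda>\<phi>. of_bool (satisfies \<sigma> \<phi>) * of_bool (split_score l \<phi> \<le> \<tau> * m))
    = ?E l (\<lambda>\<phi>. ?E m (\<lambda>\<psi>. of_bool (satisfies \<sigma> (\<phi> @ \<psi>)) * of_bool (split_score l (\<phi> @ \<psi>) \<le> \<tau> * m)))"
    by (rule expectation_replicate_append[OF finite_support])
  also have "\<dots> \<le> ?E l (\<lambda>\<phi>. rho ^ m * exp (t * \<delta> * n) *
        (of_bool (satisfies \<sigma> \<phi>) * exp (- t * balance n \<sigma> (?s \<phi>)))
      + rho ^ m * ?B * of_bool (satisfies \<sigma> \<phi>))"
  proof (rule integral_mono_AE[OF integrable_formula integrable_formula], rule AE_pmfI)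
    fix \<phi> assume "\<phi> \<in> set_pmf (replicate_pmf l (random_clause k n))"
    hence len: "length \<phi> = l" by (simp add: set_replicate_pmf)
    have "?E m (\<lambda>\<psi>. of_bool (satisfies \<sigma> (\<phi> @ \<psi>)) * of_bool (split_score l (\<phi> @ \<psi>) \<le> \<tau> * m))
      = of_bool (satisfies \<sigma> \<phi>) *
        ?E m (\<lambda>\<psi>. of_bool (satisfies \<sigma> \<psi>) * of_bool (score (?s \<phi>) \<psi> \<le> \<tau> * m))"
      by (simp add: satisfies_append split_score_def len mult.assoc)
    also have "\<dots> \<le> of_bool (satisfies \<sigma> \<phi>) *
        (rho ^ m * (exp (t * (\<delta> * n - balance n \<sigma> (?s \<phi>))) + ?B))"
      by (intro mult_left_mono inner) simp
    also have "exp (t * (\<delta> * n - balance n \<sigma> (?s \<phi>)))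
        = exp (t * \<delta> * n) * exp (- t * balance n \<sigma> (?s \<phi>))"
      by (simp add: exp_add[symmetric] algebra_simps)
    finally show "?E m (\<lambda>\<psi>. of_bool (satisfies \<sigma> (\<phi> @ \<psi>)) * of_bool (split_score l (\<phi> @ \<psi>) \<le> \<tau> * m))
      \<le> rho ^ m * exp (t * \<delta> * n) * (of_bool (satisfies \<sigma> \<phi>) * exp (- t * balance n \<sigma> (?s \<phi>)))
        + rho ^ m * ?B * of_bool (satisfies \<sigma> \<phi>)"
      by (simp only: distrib_left mult_ac)
  qed
  also have "\<dots> = rho ^ m * exp (t * \<delta> * n) *
        ?E l (\<lambda>\<phi>. of_bool (satisfies \<sigma> \<phi>) * exp (- t * balance n \<sigma> (?s \<phi>)))
      + rho ^ m * ?B * ?E l (\<lambda>\<phi>. of_bool (satisfies \<sigma> \<phi>))"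
    by (subst Bochner_Integration.integral_add[OF integrable_formula integrable_formula])
       (simp only: integral_mult_right_zero)
  also have "\<dots> \<le> rho ^ m * exp (t * \<delta> * n) * (rho * exp (t\<^sup>2 - t * (beta / 2))) ^ l
      + rho ^ m * ?B * rho ^ l"
  proof (rule add_mono[OF mult_left_mono])
    \<comment> \<open>Learning starts from the empty memory, where the balance is 0 and the
      condition on the memory reads \<open>2 * l \<le> n\<close>.\<close>
    show "?E l (\<lambda>\<phi>. of_bool (satisfies \<sigma> \<phi>) * exp (- t * balance n \<sigma> (?s \<phi>)))
      \<le> (rho * exp (t\<^sup>2 - t * (beta / 2))) ^ l"
      using sat_memory_chernoff[of "\<lambda>_. 0" l t \<sigma>] l t by (simp add: balance_def)
  qed (use rho_pos in \<open>auto simp: expectation_sat_formula\<close>)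
  also have "\<dots> = rho ^ (l + m) * (exp (t * \<delta> * n + l * (t\<^sup>2 - t * (beta / 2))) + ?B)"
    by (simp add: power_mult_distrib power_add exp_of_nat_mult exp_add distrib_left mult_ac)
  finally show ?thesis .
qed

text \<open>The scored clauses are independent of the memory, so the bound for a fixed vector
  applies whatever was learned.\<close>

lemma unif_score_large:
  fixes t \<tau> :: real
  assumes t: "0 \<le> t" "t \<le> 1"
  shows "measure_pmf.expectation (replicate_pmf (l + m) (random_clause k n))
           (\<lambda>\<phi>. of_bool (\<tau> * m < split_score l \<phi>)) \<le> exp (m * (t\<^sup>2 - t * \<tau>))"
proof -
  let ?E = "\<lambda>m. measure_pmf.expectation (replicate_pmf m (random_clause k n)) :: (formula \<Rightarrow> real) \<Rightarrow> real"
  let ?s = "\<lambda>\<phi>. fold remember \<phi> (\<lambda>_. 0)"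
  have s: "\<bar>?s \<phi> x\<bar> \<le> 1" for \<phi> x by (rule abs_fold_remember) simp
  have inner: "?E m (\<lambda>\<psi>. of_bool (\<tau> * m < score (?s \<phi>) \<psi>)) \<le> exp (m * (t\<^sup>2 - t * \<tau>))" for \<phi>
  proof -
    have "?E m (\<lambda>\<psi>. of_bool (\<tau> * m < score (?s \<phi>) \<psi>))
      \<le> ?E m (\<lambda>\<psi>. exp (- t * \<tau> * m) * exp (t * score (?s \<phi>) \<psi>))"
    proof (rule integral_mono[OF integrable_formula integrable_formula])
      fix \<psi>
      have "of_bool (\<tau> * m < score (?s \<phi>) \<psi>) \<le> exp (t * (score (?s \<phi>) \<psi> - \<tau> * m))"
        using t by (auto simp: of_bool_def)
      thus "of_bool (\<tau> * m < score (?s \<phi>) \<psi>) \<le> exp (- t * \<tau> * m) * exp (t * score (?s \<phi>) \<psi>)"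
        by (simp add: exp_add[symmetric] algebra_simps)
    qed
    also have "\<dots> \<le> exp (- t * \<tau> * m) * exp (t\<^sup>2) ^ m"
      unfolding integral_mult_right_zero by (intro mult_left_mono unif_score_chernoff s t) simp
    also have "\<dots> = exp (m * (t\<^sup>2 - t * \<tau>))"
      by (simp add: exp_of_nat_mult[symmetric] exp_add[symmetric] algebra_simps)
    finally show ?thesis .
  qed
  have "?E (l + m) (\<lambda>\<phi>. of_bool (\<tau> * m < split_score l \<phi>))
    = ?E l (\<lambda>\<phi>. ?E m (\<lambda>\<psi>. of_bool (\<tau> * m < split_score l (\<phi> @ \<psi>))))"
    by (rule expectation_replicate_append[OF finite_support])
  also have "\<dots> \<le> ?E l (\<lambda>_. exp (m * (t\<^sup>2 - t * \<tau>)))"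
  proof (rule integral_mono_AE[OF integrable_formula integrable_formula], rule AE_pmfI)
    fix \<phi> assume "\<phi> \<in> set_pmf (replicate_pmf l (random_clause k n))"
    hence "length \<phi> = l" by (simp add: set_replicate_pmf)
    thus "?E m (\<lambda>\<psi>. of_bool (\<tau> * m < split_score l (\<phi> @ \<psi>))) \<le> exp (m * (t\<^sup>2 - t * \<tau>))"
      using inner[of \<phi>] by (simp add: split_score_def)
  qed
  finally show ?thesis by simp
qed

end

section \<open>The mean of Z and Markov's inequality\<close>

lemma finite_assignments: "finite (assignments n)"
  by (simp add: assignments_def finite_PiE)

lemma Z_eq_sum: "real (Z n \<phi>) = (\<Sum>\<sigma>\<in>assignments n. of_bool (satisfies \<sigma> \<phi>))"
  by (simp add: Z_def finite_assignments sum.If_cases of_bool_def Int_def)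

context clause_params
begin

lemma expectation_Z:
  "measure_pmf.expectation (P_unif k n m) (\<lambda>\<phi>. real (Z n \<phi>)) = card (assignments n) * rho ^ m"
  by (simp add: Z_eq_sum P_unif_def Bochner_Integration.integral_sum integrable_formula
      expectation_sat_formula)

lemma expectation_Z_pos: "0 < measure_pmf.expectation (P_unif k n m) (\<lambda>\<phi>. real (Z n \<phi>))"
proof -
  have "assignments n \<noteq> {}" by (simp add: assignments_def PiE_eq_empty_iff)
  thus ?thesis
    unfolding expectation_Z using rho_pos finite_assignments by (simp add: card_gt_0_iff)
qed

text \<open>The planted bound is the same for every assignment, and each assignment contributes
  \<open>rho ^ (l + m)\<close> to the mean of \<open>Z\<close>; summing over assignments leads from
  the planted model back to \<open>Z\<close>.\<close>

lemma expectation_Z_score_small: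
  fixes t u \<delta> \<tau> :: real
  assumes "2 * l \<le> n" "0 \<le> t" "t \<le> 1" "0 \<le> u" "u \<le> 1"
  shows "measure_pmf.expectation (P_unif k n (l + m))
           (\<lambda>\<phi>. real (Z n \<phi>) * of_bool (split_score l \<phi> \<le> \<tau> * m))
         \<le> measure_pmf.expectation (P_unif k n (l + m)) (\<lambda>\<phi>. real (Z n \<phi>)) *
           (exp (t * \<delta> * n + l * (t\<^sup>2 - t * (beta / 2)))
             + exp (m * (u * \<tau> + u\<^sup>2 - u * (beta * \<delta>))))" (is "?L \<le> _ * ?B")
proof -
  have "?L = (\<Sum>\<sigma>\<in>assignments n. measure_pmf.expectation (P_unif k n (l + m))
      (\<lambda>\<phi>. of_bool (satisfies \<sigma> \<phi>) * of_bool (split_score l \<phi> \<le> \<tau> * m)))"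
    unfolding Z_eq_sum sum_distrib_right P_unif_def
    by (rule Bochner_Integration.integral_sum) (rule integrable_formula)
  also have "\<dots> \<le> (\<Sum>\<sigma>\<in>assignments n. rho ^ (l + m) * ?B)"
    unfolding P_unif_def by (intro sum_mono planted_score_small assms)
  finally show ?thesis
    unfolding expectation_Z by simp
qed

text \<open>A formula outside the event has either a large score, which is rare under the uniform
  law, or a small score and a large \<open>Z\<close>, where Markov's inequality costs the factor
  \<open>exp (c * n)\<close>.\<close>

lemma prob_Z_small:
  fixes c t u v \<delta> \<tau> :: real
  assumes "2 * l \<le> n" "0 \<le> t" "t \<le> 1" "0 \<le> u" "u \<le> 1" "0 \<le> v" "v \<le> 1"
  shows "1 - (exp (m * (v\<^sup>2 - v * \<tau>)) + exp (c * n) *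
           (exp (t * \<delta> * n + l * (t\<^sup>2 - t * (beta / 2)))
             + exp (m * (u * \<tau> + u\<^sup>2 - u * (beta * \<delta>)))))
         \<le> measure_pmf.prob (P_unif k n (l + m)) {\<phi>. real (Z n \<phi>) <
             exp (- c * n) * measure_pmf.expectation (P_unif k n (l + m)) (\<lambda>\<psi>. real (Z n \<psi>))}"
    (is "1 - (?A + exp (c * n) * ?B) \<le> measure_pmf.prob ?p ?G")
proof -
  let ?E = "measure_pmf.expectation ?p :: (formula \<Rightarrow> real) \<Rightarrow> real"
  let ?EZ = "?E (\<lambda>\<psi>. real (Z n \<psi>))"
  have int: "integrable ?p f" for f :: "formula \<Rightarrow> real"
    unfolding P_unif_def by (rule integrable_formula)
  have "1 - measure_pmf.prob ?p ?G = measure_pmf.prob ?p (- ?G)"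
    using measure_pmf.prob_compl[of ?G ?p] by (simp add: Compl_eq_Diff_UNIV)
  also have "\<dots> = ?E (indicator (- ?G))"
    by simp
  also have "\<dots> \<le> ?E (\<lambda>\<phi>. of_bool (\<tau> * m < split_score l \<phi>)
      + exp (c * n) / ?EZ * (real (Z n \<phi>) * of_bool (split_score l \<phi> \<le> \<tau> * m)))"
  proof (rule integral_mono[OF int int])
    fix \<phi>
    have "1 \<le> exp (c * n) / ?EZ * real (Z n \<phi>)" if "\<phi> \<notin> ?G"
      using that expectation_Z_pos[of "l + m"] by (simp add: exp_minus field_simps)
    moreover have "0 \<le> exp (c * n) / ?EZ * real (Z n \<phi>)"
      using expectation_Z_pos[of "l + m"] by simp
    ultimately show "indicator (- ?G) \<phi> \<le> of_bool (\<tau> * m < split_score l \<phi>)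
      + exp (c * n) / ?EZ * (real (Z n \<phi>) * of_bool (split_score l \<phi> \<le> \<tau> * m))"
      by (cases "\<phi> \<in> ?G"; cases "split_score l \<phi> \<le> \<tau> * m") auto
  qed
  also have "\<dots> = ?E (\<lambda>\<phi>. of_bool (\<tau> * m < split_score l \<phi>))
      + exp (c * n) / ?EZ * ?E (\<lambda>\<phi>. real (Z n \<phi>) * of_bool (split_score l \<phi> \<le> \<tau> * m))"
    by (subst Bochner_Integration.integral_add[OF int int]) (simp only: integral_mult_right_zero)
  also have "\<dots> \<le> ?A + exp (c * n) / ?EZ * (?EZ * ?B)"
  proof (rule add_mono[OF _ mult_left_mono])
    show "?E (\<lambda>\<phi>. of_bool (\<tau> * m < split_score l \<phi>)) \<le> ?A"
      unfolding P_unif_def by (rule unif_score_large) (use assms in auto)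
    show "?E (\<lambda>\<phi>. real (Z n \<phi>) * of_bool (split_score l \<phi> \<le> \<tau> * m)) \<le> ?EZ * ?B"
      by (rule expectation_Z_score_small) (use assms in auto)
  qed (use expectation_Z_pos[of "l + m"] in simp)
  also have "\<dots> = ?A + exp (c * n) * ?B"
    using expectation_Z_pos[of "l + m"] by simp
  finally show ?thesis by simp
qed

end

section \<open>Choice of the constants\<close>

text \<open>About \<open>\<alpha> * n\<close> clauses are used for learning, at most n / 2 and at
  most m / 2. The required surplus is \<delta> = beta * \<alpha> / 16, so \<open>\<gamma>\<close> is
  beta * \<delta>, the planted drift of the score per clause. The threshold \<tau> = \<gamma> / 4
  lies between it and the uniform mean 0.\<close>

lemma prob_Z_exponentially_small:
  fixes \<Delta> :: real
  assumes k: "k \<ge> 1" and \<Delta>: "\<Delta> > 0"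
  defines "\<alpha> \<equiv> min (1 / 2) (\<Delta> / 2)"
  defines "\<gamma> \<equiv> (1 / (2 ^ k - 1))\<^sup>2 * \<alpha> / 16"
  defines "c \<equiv> \<alpha> * \<gamma>\<^sup>2 / 128"
  assumes n: "k \<le> n" "1 \<le> \<alpha> * n" and m: "real m = \<Delta> * n"
  shows "1 - 3 * exp (- c * n) \<le> measure_pmf.prob (P_unif k n m) {\<phi>. real (Z n \<phi>) <
           exp (- c * n) * measure_pmf.expectation (P_unif k n m) (\<lambda>\<psi>. real (Z n \<psi>))}"
proof -
  interpret clause_params k n
    by unfold_locales (use k n in auto)
  have \<alpha>: "0 < \<alpha>" "\<alpha> \<le> 1 / 2" "\<alpha> \<le> \<Delta> / 2"
    using \<Delta> by (auto simp: \<alpha>_def)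
  have \<gamma>_eq: "\<gamma> = beta\<^sup>2 * \<alpha> / 16"
    by (simp add: \<gamma>_def beta_def)
  have \<gamma>_pos: "0 < \<gamma>"
    using beta_pos \<alpha> by (simp add: \<gamma>_eq)
  have "beta\<^sup>2 * \<alpha> \<le> 1 * (1 / 2)"
    using beta_pos beta_le \<alpha> by (intro mult_mono) (auto simp: power_le_one)
  hence \<gamma>_le: "\<gamma> \<le> 1 / 32"
    by (simp add: \<gamma>_eq mult_ac)
  define l where "l = nat \<lfloor>\<alpha> * n\<rfloor>"
  define m' where "m' = m - l"
  have l_real: "real l = of_int \<lfloor>\<alpha> * n\<rfloor>"
    using n by (simp add: l_def)
  have l_le: "real l \<le> \<alpha> * n"
    unfolding l_real by linarith
  \<comment> \<open>The floor of a number that is at least 1 is at least half of it.\<close>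
  have "1 \<le> \<lfloor>\<alpha> * n\<rfloor>" using n by simp
  hence l_ge: "\<alpha> * n / 2 \<le> real l"
    unfolding l_real by linarith
  have "\<alpha> * n \<le> 1 / 2 * n"
    by (rule mult_right_mono[OF \<alpha>(2)]) simp
  moreover have "\<alpha> * n \<le> \<Delta> / 2 * n"
    by (rule mult_right_mono[OF \<alpha>(3)]) simp
  ultimately have l2: "2 * l \<le> n" and "real l \<le> \<Delta> * n / 2" and \<alpha>n: "\<alpha> * n \<le> \<Delta> * n / 2"
    using l_le by auto
  hence "l \<le> m" and m'_ge: "\<alpha> * n \<le> real m'"
    using m \<Delta> by (auto simp: m'_def of_nat_diff)
  hence m_eq: "m = l + m'" by (simp add: m'_def)
  have cn: "2 * c * n = \<alpha> * n * \<gamma>\<^sup>2 / 64"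
    by (simp add: c_def)
  \<comment> \<open>Here v = \<gamma> / 8 minimizes v^2 - v * \<tau>. All three exponents are
    brought below -2cn, so that the factor \<open>exp (c * n)\<close> can be absorbed.\<close>
  have "m' * ((\<gamma> / 8)\<^sup>2 - \<gamma> / 8 * (\<gamma> / 4)) = - (m' * \<gamma>\<^sup>2 / 64)"
    by (simp add: power2_eq_square field_simps)
  also have "\<dots> \<le> - (2 * c * n)"
    unfolding cn using m'_ge by (simp add: mult_right_mono)
  finally have 1: "m' * ((\<gamma> / 8)\<^sup>2 - \<gamma> / 8 * (\<gamma> / 4)) \<le> - (2 * c * n)" .
  have "m' * (\<gamma> / 4 * (\<gamma> / 4) + (\<gamma> / 4)\<^sup>2 - \<gamma> / 4 * (beta * (beta * \<alpha> / 16))) = - (m' * \<gamma>\<^sup>2 / 8)"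
  proof -
    have "beta * (beta * \<alpha> / 16) = \<gamma>" by (simp add: \<gamma>_eq power2_eq_square)
    thus ?thesis by (simp add: power2_eq_square field_simps)
  qed
  also have "\<dots> \<le> - (m' * \<gamma>\<^sup>2 / 64)"
    by simp
  also have "\<dots> \<le> - (2 * c * n)"
    unfolding cn using m'_ge by (simp add: mult_right_mono)
  finally have 2: "m' * (\<gamma> / 4 * (\<gamma> / 4) + (\<gamma> / 4)\<^sup>2 - \<gamma> / 4 * (beta * (beta * \<alpha> / 16))) \<le> - (2 * c * n)" .
  \<comment> \<open>Here t = beta / 4 minimizes t^2 - t * beta / 2, with value -beta^2 / 16. As l is
    at least \<alpha> * n / 2, this gains \<gamma> * n / 2, twice the cost t * \<delta> * n.\<close>
  have "beta / 4 * (beta * \<alpha> / 16) * n + l * ((beta / 4)\<^sup>2 - beta / 4 * (beta / 2))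
      = \<gamma> * n / 4 - l * (beta\<^sup>2 / 16)"
    by (simp add: \<gamma>_eq power2_eq_square field_simps)
  also have "\<dots> \<le> \<gamma> * n / 4 - \<alpha> * n / 2 * (beta\<^sup>2 / 16)"
    using l_ge by (intro diff_left_mono mult_right_mono) auto
  also have "\<dots> = - (\<gamma> * n / 4)"
    by (simp add: \<gamma>_eq field_simps)
  also have "\<dots> \<le> - (2 * c * n)"
  proof -
    have "\<alpha> * \<gamma> \<le> 1 * 1"
      using \<alpha> \<gamma>_le \<gamma>_pos by (intro mult_mono) auto
    hence "\<gamma> * n * (\<alpha> * \<gamma>) \<le> \<gamma> * n * 16"
      using \<gamma>_pos by (intro mult_left_mono) auto
    thus ?thesis unfolding cn by (simp add: power2_eq_square mult_ac)
  qed
  finally have 3: "beta / 4 * (beta * \<alpha> / 16) * n + l * ((beta / 4)\<^sup>2 - beta / 4 * (beta / 2)) \<le> - (2 * c * n)" .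
  have "1 - (exp (m' * ((\<gamma> / 8)\<^sup>2 - \<gamma> / 8 * (\<gamma> / 4))) + exp (c * n) *
           (exp (beta / 4 * (beta * \<alpha> / 16) * n + l * ((beta / 4)\<^sup>2 - beta / 4 * (beta / 2)))
             + exp (m' * (\<gamma> / 4 * (\<gamma> / 4) + (\<gamma> / 4)\<^sup>2 - \<gamma> / 4 * (beta * (beta * \<alpha> / 16))))))
      \<le> measure_pmf.prob (P_unif k n m) {\<phi>. real (Z n \<phi>) <
           exp (- c * n) * measure_pmf.expectation (P_unif k n m) (\<lambda>\<psi>. real (Z n \<psi>))}"
    unfolding m_eq
    by (rule prob_Z_small) (use l2 beta_pos beta_le \<gamma>_pos \<gamma>_le in auto)
  moreover have "exp (m' * ((\<gamma> / 8)\<^sup>2 - \<gamma> / 8 * (\<gamma> / 4))) + exp (c * n) *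
           (exp (beta / 4 * (beta * \<alpha> / 16) * n + l * ((beta / 4)\<^sup>2 - beta / 4 * (beta / 2)))
             + exp (m' * (\<gamma> / 4 * (\<gamma> / 4) + (\<gamma> / 4)\<^sup>2 - \<gamma> / 4 * (beta * (beta * \<alpha> / 16)))))
      \<le> exp (- (2 * c * n)) + exp (c * n) * (exp (- (2 * c * n)) + exp (- (2 * c * n)))"
    using 1 2 3 by (intro add_mono mult_left_mono) auto
  moreover have "exp (c * n) * (exp (- (2 * c * n)) + exp (- (2 * c * n))) = 2 * exp (- c * n)"
    by (simp add: exp_add[symmetric] distrib_left)
  moreover have "exp (- (2 * c * n)) \<le> exp (- c * n)"
    using \<alpha> by (simp add: c_def)
  ultimately show ?thesis by linarith
qed

theorem lemma2p3:
  fixes k :: nat and \<Delta> :: real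
  assumes "k \<ge> 2" and "\<Delta> > 0"
  shows "\<exists>c::real. c > 0 \<and>
    (\<exists>(\<epsilon> :: nat \<Rightarrow> real) (m\<^sub>0 :: nat). \<epsilon> \<in> o(\<lambda>_. 1) \<and>
      (\<forall>n m :: nat. n \<ge> k \<and> m > 0 \<and> real m = \<Delta> * real n \<and> m \<ge> m\<^sub>0 \<longrightarrow>
        measure_pmf.prob (P_unif k n m)
          {\<phi>. real (Z n \<phi>) <
             exp (- c * real n) * measure_pmf.expectation (P_unif k n m) (\<lambda>\<psi>. real (Z n \<psi>))}
        \<ge> 1 - \<epsilon> n))"
proof -
  define \<alpha> where "\<alpha> = min (1 / 2) (\<Delta> / 2)"
  define \<gamma> :: real where "\<gamma> = (1 / (2 ^ k - 1))\<^sup>2 * \<alpha> / 16"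
  define c where "c = \<alpha> * \<gamma>\<^sup>2 / 128"
  have \<alpha>: "0 < \<alpha>" using assms by (simp add: \<alpha>_def)
  have "(1::real) < 2 ^ k" using assms by (intro one_less_power) auto
  hence c: "0 < c" using \<alpha> by (simp add: c_def \<gamma>_def)
  \<comment> \<open>From \<open>m\<^sub>0\<close> on, \<Delta> * n = m is at least \<Delta> /
    \<alpha>, which is \<open>1 \<le> \<alpha> * n\<close>.\<close>
  define m\<^sub>0 where "m\<^sub>0 = nat \<lceil>\<Delta> / \<alpha>\<rceil>"
  \<comment> \<open>One exponential comes from the uniform model and two from the planted
    model.\<close>
  let ?\<epsilon> = "\<lambda>n::nat. 3 * exp (- c * real n)"
  have "?\<epsilon> \<longlonglongrightarrow> 0"
    using c by real_asymp
  hence "?\<epsilon> \<in> o(\<lambda>_. 1)"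
    by (intro smalloI_tendsto) auto
  moreover have "1 - ?\<epsilon> n \<le> measure_pmf.prob (P_unif k n m) {\<phi>. real (Z n \<phi>) <
      exp (- c * real n) * measure_pmf.expectation (P_unif k n m) (\<lambda>\<psi>. real (Z n \<psi>))}"
    if "n \<ge> k" "real m = \<Delta> * real n" "m \<ge> m\<^sub>0" for n m
  proof -
    have "\<Delta> / \<alpha> \<le> \<Delta> * n"
      using that by (simp add: m\<^sub>0_def)
    hence "1 \<le> \<alpha> * n"
      using assms \<alpha> by (simp add: field_simps)
    thus ?thesis
      using prob_Z_exponentially_small[of k \<Delta> n m] assms that
      unfolding \<alpha>_def c_def \<gamma>_def by simp
  qed
  ultimately show ?thesis
    using c by blast
qed

end
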